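(* Let $K\subset\mathbb{R}^d$ be an open convex body. Suppose that $\mathbb{B}(o,\gamma)\subset K\subset\mathbb{B}(o,1/2)$ for some $\gamma\in(0,1/2]$. Let $\delta\in(0,1/2]$ be such that $o\in K_\delta$. Then $$B_K\left(o,\ \frac{1}{2d}\ln\frac1\delta+\frac{1}{2d}\ln\frac{2^{2d-1}\gamma^{3d}\omega_d}{|K|}\right)\subset K_\delta\subset B_K\left(o,\ \frac12\ln\frac1\delta+\frac12\ln\frac{d(1+2\gamma)}{4\sqrt3\,\gamma^2\,|K|}\right),$$ where the ball on the left-hand side is nonempty only when $\delta\,|K|<2^{2d-1}\gamma^{3d}\omega_d$.
   Context: An open convex body is a nonempty, bounded, open convex subset of $\mathbb{R}^d$. $o$ is the origin, $\mathbb{B}(x,r)$ is the open Euclidean ball of radius $r$ centered at $x$, $|S|$ is Lebesgue volume, and $\omega_d=|\mathbb{B}(o,1)|$. The $\delta$-depth-trimmed region of $K$ is $K_\delta=\{q\in\mathbb{R}^d: D_K(q)\ge\delta\}$, where $D_K(q)=\inf\{|\{z\in K:\langle v,z-q\rangle\ge0\}|/|K| : v\in\mathbb{R}^d,\ \|v\|=1\}$ is the halfspace depth. The Hilbert metric on $K$: for distinct $p,q\in K$, let $a,b$ be the points where the line through $p$ and $q$ meets the boundary of $K$, labelled so that $a,p,q,b$ are in consecutive order; then $d_K(p,q)=\frac12\ln\frac{\|q-a\|\,\|p-b\|}{\|p-a\|\,\|q-b\|}$, and $d_K(p,p)=0$. For $x\in K$, $B_K(x,r)=\{y\in K:d_K(x,y)<r\}$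 if $r>0$, and $B_K(x,r)=\emptyset$ if $r\le0$. *)

theory Defs
  imports "HOL-Analysis.Analysis"
begin

definition open_convex_body :: "(real ^ 'n) set \<Rightarrow> bool" where
  "open_convex_body K \<longleftrightarrow> K \<noteq> {} \<and> bounded K \<and> open K \<and> convex K"

abbreviation vol :: "(real ^ 'n) set \<Rightarrow> real" where
  "vol S \<equiv> measure lebesgue S"

text \<open>The infimum is that of a nonempty set of reals contained in the unit interval, whenever
  \<open>K\<close> is an open convex body.\<close>

definition halfspace_depth :: "(real ^ 'n) set \<Rightarrow> real ^ 'n \<Rightarrow> real" where
  "halfspace_depth K q = (INF v \<in> {v. norm v = 1}. vol {z \<in> K. v \<bullet> (z - q) \<ge> 0} / vol K)"

definition depth_region :: "(real ^ 'n) set \<Rightarrow> real \<Rightarrow> (real ^ 'n) set" where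
  "depth_region K \<delta> = {q. halfspace_depth K q \<ge> \<delta>}"

text \<open>For distinct points, the two open-segment conditions say that \<open>a\<close>, \<open>p\<close>, \<open>q\<close>, \<open>b\<close> are
  distinct collinear points occurring in this order. When \<open>K\<close> is an open convex body and
  \<open>p\<close>, \<open>q\<close> lie in \<open>K\<close>, they determine the boundary points \<open>a\<close> and \<open>b\<close> uniquely, so the definite
  description is proper.\<close>

definition hilbert_dist :: "(real ^ 'n) set \<Rightarrow> real ^ 'n \<Rightarrow> real ^ 'n \<Rightarrow> real" where
  "hilbert_dist K p q =
    (if p = q then 0
     else (THE r. \<exists>a b. a \<in> frontier K \<and> b \<in> frontier K \<and>
             p \<in> open_segment a q \<and> q \<in> open_segment p b \<and>
             r = 1 / 2 * ln ((norm (q - a) * norm (p - b)) / (norm (p - a) * norm (q - b)))))"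

definition hilbert_ball :: "(real ^ 'n) set \<Rightarrow> real ^ 'n \<Rightarrow> real \<Rightarrow> (real ^ 'n) set" where
  "hilbert_ball K x r = (if r > 0 then {y \<in> K. hilbert_dist K x y < r} else {})"

end

(* Let the chord of K through the origin o and a point p be a, o, p, b.
   Inner inclusion: the homothety centred at b that takes o to p takes the ball B(o, gamma) to a
   ball around p inside K whose radius is at least gamma * exp (-2 d(o, p)), and every halfspace
   bounded by a hyperplane through p contains half of that ball.
   Outer inclusion: cut off a cap of K by the hyperplane through p parallel to one that supports
   K at b. The cap has width at most |b - p| and lies in a unit cube, and some coordinate axis
   crosses the slab around it in a segment of length at most d |b - p|, so its volume is at most
   d |b - p|. This bounds the depth of p in terms of |b - p|, which controls d(o, p). *)
theory Submission
  imports Defs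
begin

section \<open>Volumes of slabs and half-balls\<close>

text \<open>The ball of radius 1/2 fits into a cube of side 1. In the outer inclusion this keeps the
  logarithm of the cross-ratio bound nonnegative.\<close>

lemma vol_le_1:
  fixes S :: "(real ^ 'n) set"
  assumes S: "S \<in> lmeasurable" "S \<subseteq> cball 0 (1 / 2)"
  shows "vol S \<le> 1"
proof -
  define lo hi :: "real ^ 'n" where "lo = (\<chi> i. - 1 / 2)" and "hi = (\<chi> i. 1 / 2)"
  have "S \<subseteq> cbox lo hi"
  proof
    fix z assume "z \<in> S"
    then have "norm z \<le> 1 / 2" using S(2) by auto
    then have "- 1 / 2 \<le> z $ i \<and> z $ i \<le> 1 / 2" for i
      using component_le_norm_cart[of z i] by linarith
    then show "z \<in> cbox lo hi" by (simp add: mem_box_cart lo_def hi_def)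
  qed
  then have "vol S \<le> vol (cbox lo hi)"
    using S(1) by (intro measure_mono_fmeasurable) auto
  also have "\<dots> \<le> 1"
    by (simp add: content_cbox_if_cart lo_def hi_def)
  finally show ?thesis .
qed

text \<open>Translates of \<open>S\<close> along the axis \<open>k\<close> by multiples of any \<open>t\<close> exceeding the claimed bound are
  disjoint, and \<open>N\<close> of them fit into a box of volume \<open>1 + N t\<close>.\<close>

lemma vol_slab_le_component:
  fixes S :: "(real ^ 'n) set"
  assumes S: "S \<in> lmeasurable" "S \<subseteq> cball 0 (1 / 2)" and "v $ k \<noteq> 0" and "0 \<le> h"
    and slab: "\<And>z. z \<in> S \<Longrightarrow> c \<le> v \<bullet> z \<and> v \<bullet> z \<le> c + h"
  shows "vol S \<le> h / \<bar>v $ k\<bar>"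
proof -
  \<comment> \<open>A strictly larger \<open>t\<close> makes the translates disjoint even where the
    slab has exact width \<open>h\<close>; the claim follows by letting \<open>t\<close> decrease to
    the bound.\<close>
  have bound: "vol S \<le> t" if t: "h / \<bar>v $ k\<bar> < t" for t
  proof -
    have t0: "0 < t" using t \<open>0 \<le> h\<close> by (smt (verit) divide_nonneg_nonneg abs_ge_zero)
    have ht: "h < t * \<bar>v $ k\<bar>" using t assms(3) by (simp add: pos_divide_less_eq)
    define A where "A j = (+) ((real j * t) *\<^sub>R axis k 1) ` S" for j :: nat
    have mA: "A j \<in> lmeasurable" for j
      unfolding A_def by (rule measurable_translation[OF S(1)])
    have vA: "vol (A j) = vol S" for j
      unfolding A_def by (rule measure_translation)
    have disj: "disjoint_family A"
    proof -
      \<comment> \<open>Shifting from \<open>A i\<close> to \<open>A j\<close> changes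
        \<open>v \<bullet> x\<close> by \<open>(j - i) * t * v $ k\<close>, which in absolute value
        exceeds the slab width \<open>h\<close> as soon as \<open>i \<noteq> j\<close>.\<close>
      have False if "x \<in> A i" "x \<in> A j" "i \<noteq> j" for x i j
      proof -
        obtain y z where yz: "y \<in> S" "z \<in> S" "x = (real i * t) *\<^sub>R axis k 1 + y"
          "x = (real j * t) *\<^sub>R axis k 1 + z"
          using \<open>x \<in> A i\<close> \<open>x \<in> A j\<close> unfolding A_def by blast
        have vx: "v \<bullet> x = real i * t * v $ k + v \<bullet> y"
          unfolding yz(3) by (simp add: inner_add_right inner_axis)
        have vx': "v \<bullet> x = real j * t * v $ k + v \<bullet> z"
          unfolding yz(4) by (simp add: inner_add_right inner_axis)
        have "(real i - real j) * (t * v $ k) = v \<bullet> z - v \<bullet> y"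
          using vx vx' by (simp add: left_diff_distrib)
        then have "\<bar>real i - real j\<bar> * (t * \<bar>v $ k\<bar>) = \<bar>v \<bullet> z - v \<bullet> y\<bar>"
          using t0 by (metis abs_mult abs_of_pos)
        also have "\<dots> \<le> h" using slab[OF yz(1)] slab[OF yz(2)] by linarith
        finally have "\<bar>real i - real j\<bar> * (t * \<bar>v $ k\<bar>) < 1 * (t * \<bar>v $ k\<bar>)" using ht by linarith
        moreover have "0 \<le> t * \<bar>v $ k\<bar>" using t0 by simp
        ultimately have "\<bar>real i - real j\<bar> < 1" by (rule mult_right_less_imp_less)
        then show False using \<open>i \<noteq> j\<close> by linarith
      qed
      then show ?thesis unfolding disjoint_family_on_def by blast
    qed
    have pack: "real N * vol S \<le> 1 + real N * t" for N
    proof -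
      \<comment> \<open>The unit cube, stretched by \<open>N * t\<close> along axis \<open>k\<close>
        so as to hold all \<open>N\<close> translates.\<close>
      define lo hi :: "real ^ 'n" where "lo = (\<chi> i. - 1 / 2)"
        and "hi = (\<chi> i. if i = k then 1 / 2 + real N * t else 1 / 2)"
      have sub: "A j \<subseteq> cbox lo hi" if "j < N" for j
      proof
        fix x assume "x \<in> A j"
        then obtain z where z: "z \<in> S" "x = (real j * t) *\<^sub>R axis k 1 + z"
          unfolding A_def by blast
        have "norm z \<le> 1 / 2" using subsetD[OF S(2) z(1)] by simp
        then have zi: "- 1 / 2 \<le> z $ i \<and> z $ i \<le> 1 / 2" for i
          using component_le_norm_cart[of z i] by linarith
        have "0 \<le> real j * t" "real j * t \<le> real N * t"
          using t0 that by simp_all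
        then have "lo $ i \<le> x $ i \<and> x $ i \<le> hi $ i" for i
          using zi[of i] by (cases "i = k") (simp_all add: z(2) lo_def hi_def axis_def)
        then show "x \<in> cbox lo hi" by (simp add: mem_box_cart)
      qed
      have "real N * vol S = (\<Sum>j<N. vol (A j))" by (simp add: vA)
      also have "\<dots> = vol (\<Union>j<N. A j)"
      proof (rule measure_finite_Union[symmetric])
        show "A ` {..<N} \<subseteq> sets lebesgue" using mA by (auto simp only: fmeasurableD)
        show "disjoint_family_on A {..<N}" using disj by (auto simp: disjoint_family_on_def)
        show "emeasure lebesgue (A j) \<noteq> \<infinity>" for j
          using fmeasurableD2[OF mA[of j]] unfolding infinity_ennreal_def .
      qed simp
      also have "\<dots> \<le> vol (cbox lo hi)"
        using sub mA by (intro measure_mono_fmeasurable) (auto intro!: sets.countable_UN' fmeasurableD)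
      also have "\<dots> \<le> 1 + real N * t"
      proof (cases "cbox lo hi = {}")
        case False
        then have "vol (cbox lo hi) = (\<Prod>i\<in>UNIV. hi $ i - lo $ i)"
          by (simp add: content_cbox_cart)
        also have "\<dots> = (\<Prod>i\<in>UNIV. if i = k then 1 + real N * t else 1)"
          by (rule prod.cong) (auto simp: lo_def hi_def)
        finally show ?thesis by simp
      qed (use t0 in simp)
      finally show ?thesis .
    qed
    show ?thesis
    \<comment> \<open>By \<open>pack\<close>, \<open>N * (vol S - t)\<close> stays at most 1 for
      every \<open>N\<close>, so the Archimedean property rules out a positive difference.\<close>
    proof (rule ccontr)
      assume "\<not> vol S \<le> t"
      then obtain N :: nat where "1 < real N * (vol S - t)"
        using reals_Archimedean3[of "vol S - t"] by auto
      then show False using pack[of N] by (simp add: right_diff_distrib)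
    qed
  qed
  show ?thesis
    by (rule field_le_epsilon) (rule bound, simp)
qed

text \<open>Choosing a coordinate in which the unit normal is large makes the axis cross the slab
  quickly.\<close>

lemma vol_slab_le:
  fixes S :: "(real ^ 'n) set"
  assumes S: "S \<in> lmeasurable" "S \<subseteq> cball 0 (1 / 2)" and v: "norm v = 1" and "0 \<le> h"
    and slab: "\<And>z. z \<in> S \<Longrightarrow> c \<le> v \<bullet> z \<and> v \<bullet> z \<le> c + h"
  shows "vol S \<le> real CARD('n) * h"
proof -
  \<comment> \<open>The absolute values of the coordinates of \<open>v\<close> sum to at least
    \<open>norm v = 1\<close>, so not all of them can be below the average 1/n.\<close>
  obtain k where k: "1 / real CARD('n) \<le> \<bar>v $ k\<bar>"
  proof (rule ccontr)
    assume "\<not> thesis"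
    then have "\<bar>v $ k\<bar> < 1 / real CARD('n)" for k using that by (meson not_le)
    then have "(\<Sum>k\<in>UNIV. \<bar>v $ k\<bar>) < (\<Sum>k\<in>(UNIV :: 'n set). 1 / real CARD('n))"
      by (intro sum_strict_mono) auto
    then show False using norm_le_l1_cart[of v] v by simp
  qed
  have "0 < 1 / real CARD('n)" by simp
  then have "0 < \<bar>v $ k\<bar>" using k by linarith
  then have "vol S \<le> h / \<bar>v $ k\<bar>"
    using vol_slab_le_component[OF S _ \<open>0 \<le> h\<close> slab, of k] by simp
  also have "\<dots> \<le> h / (1 / real CARD('n))"
    using k \<open>0 \<le> h\<close> \<open>0 < \<bar>v $ k\<bar>\<close> by (intro divide_left_mono) auto
  finally show ?thesis by (simp add: mult.commute)
qed

lemma halfspace_Int_lmeasurable: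
  fixes K :: "(real ^ 'n) set"
  assumes "K \<in> lmeasurable"
  shows "{z \<in> K. v \<bullet> (z - q) \<ge> 0} \<in> lmeasurable"
proof -
  have "{z \<in> K. v \<bullet> (z - q) \<ge> 0} = K \<inter> {z. v \<bullet> z \<ge> v \<bullet> q}"
    by (auto simp: inner_diff_right)
  moreover have "{z. v \<bullet> z \<ge> v \<bullet> q} \<in> sets lebesgue"
    using closed_halfspace_ge by (auto intro: lebesgue_closedin[of UNIV])
  ultimately show ?thesis using assms by (simp add: fmeasurable_Int_fmeasurable)
qed

text \<open>Reflection in the centre \<open>p\<close> preserves volume and exchanges the two
  half-balls, which together cover the ball.\<close>

lemma vol_half_ball_ge:
  fixes p :: "real ^ 'n"
  assumes "0 \<le> r"
  shows "r ^ CARD('n) * vol (ball (0 :: real ^ 'n) 1) / 2 \<le> vol {z \<in> ball p r. v \<bullet> (z - p) \<ge> 0}"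
proof -
  let ?H = "{z \<in> ball p r. v \<bullet> (z - p) \<ge> 0}"
  \<comment> \<open>The point reflection \<open>2p - z\<close>, written as a scaling plus a
    translation to match \<open>measure_lebesgue_affine\<close>.\<close>
  let ?f = "\<lambda>z. (- 1) *\<^sub>R z + 2 *\<^sub>R p"
  have H: "?H \<in> lmeasurable" by (rule halfspace_Int_lmeasurable) simp
  have vf: "vol (?f ` ?H) = vol ?H"
    by (subst measure_lebesgue_affine) simp
  have f: "?f (?f z) = z" "dist p (?f z) = dist p z" "v \<bullet> (?f z - p) = - (v \<bullet> (z - p))" for z
    by (simp_all add: dist_norm norm_minus_commute inner_simps algebra_simps scaleR_2)
  have mf: "?f ` ?H \<in> lmeasurable"
  proof -
    have "?f ` ?H = {z \<in> ball p r. (- v) \<bullet> (z - p) \<ge> 0}"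
    proof (intro equalityI subsetI)
      fix z assume "z \<in> {z \<in> ball p r. (- v) \<bullet> (z - p) \<ge> 0}"
      then have "?f z \<in> ?H" unfolding mem_Collect_eq mem_ball f by simp
      then show "z \<in> ?f ` ?H" using f(1)[of z] by (metis (no_types, lifting) image_eqI)
    next
      fix z assume "z \<in> ?f ` ?H"
      then obtain y where y: "y \<in> ?H" "z = ?f y" by blast
      then show "z \<in> {z \<in> ball p r. (- v) \<bullet> (z - p) \<ge> 0}"
        unfolding y(2) mem_Collect_eq mem_ball inner_minus_left f by simp
    qed
    then show ?thesis by (simp only:) (rule halfspace_Int_lmeasurable, simp)
  qed
  have "ball p r \<subseteq> ?H \<union> ?f ` ?H"
  proof
    fix z assume z: "z \<in> ball p r"
    have "z \<in> ?H \<or> ?f z \<in> ?H"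
      using z unfolding mem_Collect_eq mem_ball f by auto
    then show "z \<in> ?H \<union> ?f ` ?H"
      using f(1)[of z] by (metis (no_types, lifting) UnCI image_eqI)
  qed
  then have "vol (ball p r) \<le> vol (?H \<union> ?f ` ?H)"
    using H mf by (intro measure_mono_fmeasurable) auto
  also have "\<dots> \<le> vol ?H + vol (?f ` ?H)"
    using H mf by (intro measure_Un_le) auto
  finally have "vol (ball p r) \<le> 2 * vol ?H" using vf by simp
  moreover have "vol (ball p r) = r ^ CARD('n) * vol (ball (0 :: real ^ 'n) 1)"
    using content_ball_conv_unit_ball[OF assms, of p] by simp
  ultimately show ?thesis by simp
qed

section \<open>Halfspace depth\<close>

lemma halfspace_depth_le:
  assumes "norm v = 1"
  shows "halfspace_depth K q \<le> vol {z \<in> K. v \<bullet> (z - q) \<ge> 0} / vol K"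
  unfolding halfspace_depth_def
  by (rule cINF_lower) (use assms in \<open>auto intro!: bdd_belowI[of _ 0]\<close>)

text \<open>If \<open>vol K\<close> were 0, the convention \<open>x / 0 = 0\<close> would make every
  quotient in the infimum 0.\<close>

lemma vol_pos_if_halfspace_depth_pos:
  fixes K :: "(real ^ 'n) set"
  assumes "0 < halfspace_depth K q"
  shows "0 < vol K"
proof -
  have "norm (axis undefined 1 :: real ^ 'n) = 1" by simp
  then have "vol K \<noteq> 0"
    using halfspace_depth_le[of "axis undefined 1" K q] assms by (intro notI) simp
  then show ?thesis by (simp add: zero_less_measure_iff)
qed

lemma halfspace_depth_ge:
  assumes "\<And>v. norm v = 1 \<Longrightarrow> m \<le> vol {z \<in> K. v \<bullet> (z - q) \<ge> 0} / vol K"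
  shows "m \<le> halfspace_depth K q"
proof -
  \<comment> \<open>A witness that the infimum ranges over a nonempty set of directions.\<close>
  have "norm (axis undefined 1 :: real ^ 'n) = 1" by simp
  then show ?thesis
    unfolding halfspace_depth_def by (intro cINF_greatest) (use assms in blast)+
qed

text \<open>For a boundary point \<open>p\<close> of an open \<open>K\<close> this yields a
  supporting hyperplane; the unit normal makes differences of \<open>v \<bullet> z\<close> actual
  slab widths.\<close>

lemma unit_separating_functional:
  fixes K :: "'a::euclidean_space set"
  assumes "convex K" "K \<noteq> {}" "p \<notin> K"
  obtains v where "norm v = 1" "\<And>z. z \<in> K \<Longrightarrow> v \<bullet> z \<le> v \<bullet> p"
proof -
  obtain a b where ab: "a \<noteq> 0" "\<forall>x\<in>K. a \<bullet> x \<le> b" "\<forall>x\<in>{p}. a \<bullet> x \<ge> b"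
    using separating_hyperplane_sets[of K "{p}"] assms by auto
  show ?thesis
  proof (rule that[of "a /\<^sub>R norm a"])
    show "norm (a /\<^sub>R norm a) = 1" using ab(1) by simp
  next
    fix z assume "z \<in> K"
    then have "a \<bullet> z \<le> a \<bullet> p" using ab by force
    then show "(a /\<^sub>R norm a) \<bullet> z \<le> (a /\<^sub>R norm a) \<bullet> p"
      by (simp add: mult_left_mono)
  qed
qed

text \<open>The cap cut off at \<open>q\<close> in direction \<open>v\<close> lies between the
  parallel hyperplanes through \<open>q\<close> and \<open>b\<close>, whose distance is at most
  \<open>norm (b - q)\<close>. The point \<open>b\<close> is any point outside \<open>K\<close>, and
  \<open>q\<close> may lie anywhere, so that even \<open>b = q\<close> is allowed.\<close>

lemma halfspace_depth_mult_vol_le: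
  fixes K :: "(real ^ 'n) set"
  assumes K: "convex K" "open K" "K \<noteq> {}" "K \<subseteq> ball 0 (1 / 2)" and b: "b \<notin> K"
    and pos: "0 < halfspace_depth K q"
  shows "halfspace_depth K q * vol K \<le> real CARD('n) * norm (b - q)"
proof -
  have mK: "K \<in> lmeasurable"
    using K by (meson bounded_ball bounded_subset lmeasurable_open)
  obtain v where v: "norm v = 1" "\<And>z. z \<in> K \<Longrightarrow> v \<bullet> z \<le> v \<bullet> b"
    using unit_separating_functional[OF K(1,3) b] by blast
  let ?C = "{z \<in> K. v \<bullet> (z - q) \<ge> 0}"
  have "0 < vol ?C / vol K"
    using pos halfspace_depth_le[OF v(1), of K q] by linarith
  \<comment> \<open>Positive depth forces a point \<open>z\<close> in the cap, and
    \<open>v \<bullet> q \<le> v \<bullet> z \<le> v \<bullet> b\<close> makes the slab width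
    nonnegative.\<close>
  then have "?C \<noteq> {}" by force
  then have "v \<bullet> q \<le> v \<bullet> b" using v(2) by (force simp: inner_diff_right)
  then have "vol ?C \<le> real CARD('n) * (v \<bullet> b - v \<bullet> q)"
    using K(4) v(2) by (intro vol_slab_le[OF halfspace_Int_lmeasurable[OF mK] _ v(1), where c = "v \<bullet> q"])
      (auto simp: subset_iff inner_diff_right)
  also have "\<dots> \<le> real CARD('n) * norm (b - q)"
    using norm_cauchy_schwarz[of v "b - q"] v(1)
    by (intro mult_left_mono) (simp_all add: inner_diff_right)
  finally have le: "vol ?C \<le> real CARD('n) * norm (b - q)" .
  have "halfspace_depth K q * vol K \<le> vol ?C / vol K * vol K"
    using halfspace_depth_le[OF v(1), of K q] by (rule mult_right_mono) simp
  also have "\<dots> = vol ?C" using vol_pos_if_halfspace_depth_pos[OF pos] by simp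
  finally have "halfspace_depth K q * vol K \<le> vol ?C" .
  then show ?thesis using le by simp
qed

text \<open>A point \<open>q\<close> outside \<open>K\<close> could itself serve as \<open>b\<close>
  in \<open>halfspace_depth_mult_vol_le\<close>, leaving no room for positive depth.\<close>

lemma depth_region_subset:
  fixes K :: "(real ^ 'n) set"
  assumes K: "convex K" "open K" "K \<noteq> {}" "K \<subseteq> ball 0 (1 / 2)" and "0 < \<delta>"
  shows "depth_region K \<delta> \<subseteq> K"
proof
  fix q assume "q \<in> depth_region K \<delta>"
  then have q: "halfspace_depth K q > 0" using \<open>0 < \<delta>\<close> by (simp add: depth_region_def)
  show "q \<in> K"
  proof (rule ccontr)
    assume "q \<notin> K"
    then have "halfspace_depth K q * vol K \<le> 0"
      using halfspace_depth_mult_vol_le[OF K(1-4) _ q, of q] by simp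
    then show False
      using q vol_pos_if_halfspace_depth_pos[OF q] by (simp add: mult_le_0_iff)
  qed
qed

section \<open>The Hilbert metric from the origin\<close>

text \<open>All points strictly between an interior point and a point of the closure are interior,
  so the nearer of two frontier points on a ray from the origin could not be on the frontier. This
  gives uniqueness of the chord ends in \<open>hilbert_dist\<close>.\<close>

lemma frontier_ray_unique:
  fixes K :: "'a::euclidean_space set"
  assumes "convex K" "0 \<in> interior K" "0 < s" "0 < t"
    and "s *\<^sub>R x \<in> frontier K" "t *\<^sub>R x \<in> frontier K"
  shows "s = t"
proof -
  have *: False if "0 < s" "s < t" "s *\<^sub>R x \<in> frontier K" "t *\<^sub>R x \<in> frontier K" for s t
  proof -
    have "x \<noteq> 0" using that assms(2) by (auto simp: frontier_def)
    then have "s *\<^sub>R x \<in> open_segment 0 (t *\<^sub>R x)"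
      using that by (auto simp: in_segment intro!: exI[of _ "s / t"])
    moreover have "open_segment 0 (t *\<^sub>R x) \<subseteq> interior K"
      using that by (intro in_interior_closure_convex_segment assms) (simp add: frontier_def)
    ultimately show False using that by (auto simp: frontier_def)
  qed
  show ?thesis using *[of s t] *[of t s] assms by (cases s t rule: linorder_cases) auto
qed

text \<open>The chord ends are multiples of \<open>q\<close>, so all four lengths in the cross-ratio
  are multiples of \<open>norm q\<close>, which cancels.\<close>

lemma hilbert_dist_origin:
  fixes K :: "(real ^ 'n) set"
  assumes K: "open_convex_body K" "0 \<in> K" and q: "q \<in> K" "q \<noteq> 0"
  obtains \<alpha> \<beta> where "0 < \<alpha>" "1 < \<beta>" "- \<alpha> *\<^sub>R q \<in> frontier K" "\<beta> *\<^sub>R q \<in> frontier K"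
    "hilbert_dist K 0 q = 1 / 2 * ln ((1 + \<alpha>) * \<beta> / (\<alpha> * (\<beta> - 1)))"
proof -
  have Kp: "open K" "convex K" "bounded K" "interior K = K"
    using K by (auto simp: open_convex_body_def interior_open)
  have zero: "0 \<in> interior K" using K Kp by simp
  obtain \<beta> where \<beta>: "0 < \<beta>" "\<beta> *\<^sub>R q \<in> frontier K"
    using ray_to_frontier[OF Kp(3) zero q(2)] by auto
  obtain \<alpha> where \<alpha>: "0 < \<alpha>" "\<alpha> *\<^sub>R (- q) \<in> frontier K"
    using ray_to_frontier[OF Kp(3) zero, of "- q"] q(2) by auto
  \<comment> \<open>Otherwise \<open>\<beta> *\<^sub>R q\<close> would lie on the segment from the
    origin to \<open>q\<close>, hence in \<open>K\<close>, which is open and misses its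
    frontier.\<close>
  have "1 < \<beta>"
  proof (rule ccontr)
    assume "\<not> 1 < \<beta>"
    then have "(1 - \<beta>) *\<^sub>R 0 + \<beta> *\<^sub>R q \<in> K"
      using \<beta>(1) by (intro convexD Kp K q) auto
    then show False using \<beta>(2) Kp by (simp add: frontier_def)
  qed
  let ?P = "\<lambda>a b r. a \<in> frontier K \<and> b \<in> frontier K \<and>
             0 \<in> open_segment a q \<and> q \<in> open_segment 0 b \<and>
             r = 1 / 2 * ln ((norm (q - a) * norm (0 - b)) / (norm (0 - a) * norm (q - b)))"
  let ?d = "1 / 2 * ln ((1 + \<alpha>) * \<beta> / (\<alpha> * (\<beta> - 1)))"
  have val: "1 / 2 * ln ((norm (q - - \<alpha> *\<^sub>R q) * norm (0 - \<beta> *\<^sub>R q)) /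
      (norm (0 - - \<alpha> *\<^sub>R q) * norm (q - \<beta> *\<^sub>R q))) = ?d"
  proof -
    have "q - - \<alpha> *\<^sub>R q = (1 + \<alpha>) *\<^sub>R q" "q - \<beta> *\<^sub>R q = (1 - \<beta>) *\<^sub>R q"
      by (simp_all add: algebra_simps)
    then show ?thesis using \<alpha>(1) \<open>1 < \<beta>\<close> q(2) by simp
  qed
  have ex: "?P (- \<alpha> *\<^sub>R q) (\<beta> *\<^sub>R q) ?d"
  proof (intro conjI)
    \<comment> \<open>The origin divides the segment from \<open>- \<alpha> *\<^sub>R q\<close> to
      \<open>q\<close> in the ratio \<alpha> to 1, whence the weight
      \<open>\<alpha> / (1 + \<alpha>)\<close>.\<close>
    have "(1 - \<alpha> / (1 + \<alpha>)) *\<^sub>R (- \<alpha> *\<^sub>R q) + (\<alpha> / (1 + \<alpha>)) *\<^sub>R q =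
        ((1 - \<alpha> / (1 + \<alpha>)) * (- \<alpha>) + \<alpha> / (1 + \<alpha>)) *\<^sub>R q"
      by (simp only: scaleR_left_distrib scaleR_scaleR)
    also have "(1 - \<alpha> / (1 + \<alpha>)) * (- \<alpha>) + \<alpha> / (1 + \<alpha>) = 0"
      using \<alpha>(1) by (simp add: field_simps)
    finally have "0 = (1 - \<alpha> / (1 + \<alpha>)) *\<^sub>R (- \<alpha> *\<^sub>R q) + (\<alpha> / (1 + \<alpha>)) *\<^sub>R q"
      by simp
    moreover have "0 < \<alpha> / (1 + \<alpha>)" "\<alpha> / (1 + \<alpha>) < 1" using \<alpha>(1) by auto
    moreover have "- \<alpha> *\<^sub>R q \<noteq> q"
    proof
      assume "- \<alpha> *\<^sub>R q = q"
      then have "(1 + \<alpha>) *\<^sub>R q = 0" by (simp add: scaleR_left_distrib neg_eq_iff_add_eq_0 add.commute)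
      then show False using \<alpha>(1) q(2) by simp
    qed
    ultimately show "0 \<in> open_segment (- \<alpha> *\<^sub>R q) q" unfolding in_segment by blast
    show "q \<in> open_segment 0 (\<beta> *\<^sub>R q)"
      using \<open>1 < \<beta>\<close> q(2) by (auto simp: in_segment intro!: exI[of _ "1 / \<beta>"])
    show "- \<alpha> *\<^sub>R q \<in> frontier K" using \<alpha>(2) by simp
    show "\<beta> *\<^sub>R q \<in> frontier K" by (rule \<beta>(2))
  qed (rule val[symmetric])
  \<comment> \<open>The betweenness conditions put any admissible \<open>a\<close> and
    \<open>b\<close> on the rays through \<open>- q\<close> and \<open>q\<close>, where the frontier
    point is unique.\<close>
  have uniq: "r = ?d" if r: "?P a b r" for a b r
  proof -
    obtain u where u: "0 < u" "u < 1" "0 = (1 - u) *\<^sub>R a + u *\<^sub>R q"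
      using r by (auto simp: in_segment)
    obtain t where t: "0 < t" "t < 1" "q = (1 - t) *\<^sub>R 0 + t *\<^sub>R b"
      using r by (auto simp: in_segment)
    have "(1 - u) *\<^sub>R a = u *\<^sub>R (- q)" using u(3) by (simp add: eq_neg_iff_add_eq_0)
    then have "(1 - u) *\<^sub>R a = (1 - u) *\<^sub>R ((u / (1 - u)) *\<^sub>R (- q))" using u by simp
    then have a: "a = (u / (1 - u)) *\<^sub>R (- q)" using u by (simp only: scaleR_cancel_left) simp
    have b: "b = (1 / t) *\<^sub>R q" using t by simp
    have "u / (1 - u) = \<alpha>"
      by (rule frontier_ray_unique[OF Kp(2) zero, of _ _ "- q"]) (use a r \<alpha> u(1,2) in auto)
    moreover have "1 / t = \<beta>"
      by (rule frontier_ray_unique[OF Kp(2) zero, of _ _ q]) (use b r \<beta> t(1,2) in auto)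
    ultimately have ab: "a = - \<alpha> *\<^sub>R q" "b = \<beta> *\<^sub>R q" using a b by auto
    show ?thesis using r unfolding ab val by blast
  qed
  have "hilbert_dist K 0 q = (THE r. \<exists>a b. ?P a b r)"
    using q(2) by (simp add: hilbert_dist_def)
  also have "\<dots> = ?d"
  proof (rule the_equality)
    show "\<exists>a b. ?P a b ?d" using ex by (intro exI)
    show "r = ?d" if "\<exists>a b. ?P a b r" for r using that by (elim exE) (rule uniq)
  qed
  finally show ?thesis
    using that[of \<alpha> \<beta>] \<alpha> \<beta> \<open>1 < \<beta>\<close> by (simp only: scaleR_minus_right scaleR_minus_left)
qed

text \<open>The homothety with centre \<open>b\<close> and ratio \<open>1 - t\<close> sends the
  origin to \<open>t *\<^sub>R b\<close> and the ball of radius \<gamma> to the ball in question; it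
  moves points of \<open>K\<close> towards \<open>b\<close> without reaching it.\<close>

lemma homothetic_ball_subset:
  fixes K :: "'a::euclidean_space set"
  assumes K: "convex K" "open K" "ball 0 \<gamma> \<subseteq> K" "b \<in> frontier K" and t: "0 < t" "t < 1"
  shows "ball (t *\<^sub>R b) (\<gamma> * (1 - t)) \<subseteq> K"
proof
  fix z assume z: "z \<in> ball (t *\<^sub>R b) (\<gamma> * (1 - t))"
  \<comment> \<open>The preimage of \<open>z\<close> under the homothety.\<close>
  define u where "u = (z - t *\<^sub>R b) /\<^sub>R (1 - t)"
  have "norm u = norm (z - t *\<^sub>R b) / (1 - t)" using t by (simp add: u_def divide_inverse_commute)
  also have "\<dots> < \<gamma>" using z t by (simp add: dist_norm norm_minus_commute field_simps)
  finally have u: "u \<in> interior K" using K by (auto simp: interior_open)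
  have "z = (1 - t) *\<^sub>R u + t *\<^sub>R b" using t by (simp add: u_def)
  moreover have "u \<noteq> b" using u K(4) by (auto simp: frontier_def)
  ultimately have "z \<in> open_segment u b" using t by (auto simp: in_segment)
  moreover have "open_segment u b \<subseteq> interior K"
    using K u by (intro in_interior_closure_convex_segment) (auto simp: frontier_def)
  ultimately show "z \<in> K" using interior_subset by blast
qed

text \<open>With \<open>b = \<beta> *\<^sub>R p\<close>, the homothety taking the origin to
  \<open>p\<close> has ratio \<open>1 - 1 / \<beta>\<close>. Dropping the factor
  \<open>\<alpha> / (1 + \<alpha>) < 1\<close> from \<open>exp (- 2 * hilbert_dist K 0 p)\<close>
  shows that this ratio is at least that exponential.\<close>

lemma ball_exp_hilbert_dist_subset:
  fixes K :: "(real ^ 'n) set"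
  assumes K: "open_convex_body K" "ball 0 \<gamma> \<subseteq> K" "0 < \<gamma>" and p: "p \<in> K" "p \<noteq> 0"
  shows "ball p (\<gamma> * exp (- 2 * hilbert_dist K 0 p)) \<subseteq> K"
proof -
  have "0 \<in> K" using K by auto
  obtain \<alpha> \<beta> where ab: "0 < \<alpha>" "1 < \<beta>" "\<beta> *\<^sub>R p \<in> frontier K"
    and d: "hilbert_dist K 0 p = 1 / 2 * ln ((1 + \<alpha>) * \<beta> / (\<alpha> * (\<beta> - 1)))"
    using hilbert_dist_origin[OF K(1) \<open>0 \<in> K\<close> p] by metis
  have "exp (- 2 * hilbert_dist K 0 p) = \<alpha> * (\<beta> - 1) / ((1 + \<alpha>) * \<beta>)"
    using ab by (simp add: d exp_minus)
  also have "\<dots> = (\<alpha> / (1 + \<alpha>)) * (1 - 1 / \<beta>)" using ab by (simp add: field_simps)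
  also have "\<dots> \<le> 1 * (1 - 1 / \<beta>)" using ab by (intro mult_right_mono) auto
  finally have "\<gamma> * exp (- 2 * hilbert_dist K 0 p) \<le> \<gamma> * (1 - 1 / \<beta>)"
    using K(3) by simp
  moreover have "ball ((1 / \<beta>) *\<^sub>R (\<beta> *\<^sub>R p)) (\<gamma> * (1 - 1 / \<beta>)) \<subseteq> K"
    using K ab by (intro homothetic_ball_subset) (auto simp: open_convex_body_def)
  ultimately show ?thesis using ab by (force simp: subset_iff)
qed

text \<open>The cross-ratio factors as \<open>1 + 1 / \<alpha>\<close> times
  \<open>norm b / norm (b - q)\<close> with \<open>b = \<beta> *\<^sub>R q\<close>. The inner ball
  bounds the first factor; the outer ball and the depth bound the second, \<open>m\<close> being a
  lower bound for \<open>norm (b - q)\<close>.\<close>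

lemma hilbert_dist_le_ln_depth:
  fixes K :: "(real ^ 'n) set"
  assumes K: "open_convex_body K" "ball 0 \<gamma> \<subseteq> K" "K \<subseteq> ball 0 (1 / 2)" "0 < \<gamma>"
    and q: "q \<in> K" "q \<noteq> 0" and m: "0 < m" "real CARD('n) * m \<le> halfspace_depth K q * vol K"
      "0 < halfspace_depth K q"
  shows "hilbert_dist K 0 q \<le> 1 / 2 * ln ((1 + 2 * \<gamma>) / (4 * \<gamma> * m))"
proof -
  have zero: "0 \<in> K" using K by auto
  have Kp: "open K" "convex K" "K \<noteq> {}" using K by (auto simp: open_convex_body_def)
  obtain \<alpha> \<beta> where ab: "0 < \<alpha>" "1 < \<beta>" "- \<alpha> *\<^sub>R q \<in> frontier K" "\<beta> *\<^sub>R q \<in> frontier K"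
    and d: "hilbert_dist K 0 q = 1 / 2 * ln ((1 + \<alpha>) * \<beta> / (\<alpha> * (\<beta> - 1)))"
    using hilbert_dist_origin[OF K(1) zero q] by metis
  have nf: "x \<notin> K" if "x \<in> frontier K" for x
    using that Kp by (auto simp: frontier_def interior_open)
  have cl: "norm x \<le> 1 / 2" if "x \<in> frontier K" for x
    using that closure_mono[OF K(3)] by (auto simp: frontier_def subset_iff)
  have nq: "norm q > 0" "norm q \<le> 1 / 2" using q K(3) by (auto simp: subset_iff)
  have "\<beta> *\<^sub>R q - q = (\<beta> - 1) *\<^sub>R q" by (simp add: algebra_simps)
  have w: "m \<le> (\<beta> - 1) * norm q"
  proof -
    have "real CARD('n) * m \<le> real CARD('n) * norm (\<beta> *\<^sub>R q - q)"
      using halfspace_depth_mult_vol_le[OF Kp(2,1,3) K(3) nf[OF ab(4)] m(3)] m(2) by linarith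
    then have "m \<le> norm (\<beta> *\<^sub>R q - q)"
      by (rule mult_left_le_imp_le) simp
    then show ?thesis using \<open>\<beta> *\<^sub>R q - q = (\<beta> - 1) *\<^sub>R q\<close> ab(2) by simp
  qed
  have "\<beta> * norm q \<le> 1 / 2" using cl[OF ab(4)] ab(2) by simp
  \<comment> \<open>The opposite chord end lies outside the ball of radius \<gamma>, while
    \<open>norm q \<le> 1 / 2\<close>; hence \<open>\<alpha> \<ge> 2 * \<gamma>\<close>.\<close>
  moreover have "1 + 1 / \<alpha> \<le> 1 + 1 / (2 * \<gamma>)"
  proof -
    have "\<gamma> \<le> \<alpha> * norm q"
      using nf[OF ab(3)] K(2) ab(1) by (force simp: subset_iff)
    also have "\<dots> \<le> \<alpha> * (1 / 2)" using ab(1) nq by (intro mult_left_mono) auto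
    finally show ?thesis using ab(1) K(4) by (simp add: field_simps)
  qed
  ultimately have "(1 + 1 / \<alpha>) * (\<beta> * norm q / ((\<beta> - 1) * norm q)) \<le>
      (1 + 1 / (2 * \<gamma>)) * ((1 / 2) / m)"
    using w m(1) ab nq K(4) by (intro mult_mono frac_le) auto
  also have "(1 + 1 / \<alpha>) * (\<beta> * norm q / ((\<beta> - 1) * norm q)) = (1 + \<alpha>) * \<beta> / (\<alpha> * (\<beta> - 1))"
    using ab nq by (simp add: field_simps)
  also have "(1 + 1 / (2 * \<gamma>)) * ((1 / 2) / m) = (1 + 2 * \<gamma>) / (4 * \<gamma> * m)"
    using K(4) m(1) by (simp add: field_simps)
  finally have "ln ((1 + \<alpha>) * \<beta> / (\<alpha> * (\<beta> - 1))) \<le> ln ((1 + 2 * \<gamma>) / (4 * \<gamma> * m))"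
    using ab K(4) m(1) by (subst ln_le_cancel_iff) (auto intro!: divide_pos_pos mult_pos_pos)
  then show ?thesis unfolding d by simp
qed

section \<open>The comparison theorem\<close>

theorem theorem2p8:
  fixes K :: "(real ^ 'n) set" and \<gamma> \<delta> :: real
  assumes "open_convex_body K"
    and "0 < \<gamma>" and "\<gamma> \<le> 1 / 2"
    and "ball 0 \<gamma> \<subseteq> K" and "K \<subseteq> ball 0 (1 / 2)"
    and "0 < \<delta>" and "\<delta> \<le> 1 / 2"
    and "0 \<in> depth_region K \<delta>"
  shows
    "hilbert_ball K 0
       (1 / (2 * real CARD('n)) * ln (1 / \<delta>) +
        1 / (2 * real CARD('n)) *
          ln (2 ^ (2 * CARD('n) - 1) * \<gamma> ^ (3 * CARD('n)) * vol (ball (0 :: real ^ 'n) 1) / vol K))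
      \<subseteq> depth_region K \<delta> \<and>
     depth_region K \<delta> \<subseteq>
      hilbert_ball K 0
        (1 / 2 * ln (1 / \<delta>) +
         1 / 2 * ln (real CARD('n) * (1 + 2 * \<gamma>) / (4 * sqrt 3 * \<gamma>\<^sup>2 * vol K))) \<and>
     (hilbert_ball K 0
       (1 / (2 * real CARD('n)) * ln (1 / \<delta>) +
        1 / (2 * real CARD('n)) *
          ln (2 ^ (2 * CARD('n) - 1) * \<gamma> ^ (3 * CARD('n)) * vol (ball (0 :: real ^ 'n) 1) / vol K))
        \<noteq> {} \<longrightarrow>
      \<delta> * vol K < 2 ^ (2 * CARD('n) - 1) * \<gamma> ^ (3 * CARD('n)) * vol (ball (0 :: real ^ 'n) 1))"
proof -
  let ?n = "CARD('n)"
  let ?A = "2 ^ (2 * ?n - 1) * \<gamma> ^ (3 * ?n) * vol (ball (0 :: real ^ 'n) 1)"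
  let ?R1 = "1 / (2 * real ?n) * ln (1 / \<delta>) + 1 / (2 * real ?n) * ln (?A / vol K)"
  let ?B = "real ?n * (1 + 2 * \<gamma>) / (4 * sqrt 3 * \<gamma>\<^sup>2 * vol K)"
  let ?R2 = "1 / 2 * ln (1 / \<delta>) + 1 / 2 * ln ?B"
  note K = assms(1) and \<gamma> = assms(2,3) and \<delta> = assms(6,7)
  have Kp: "convex K" "open K" "K \<noteq> {}" "bounded K" using K by (auto simp: open_convex_body_def)
  have mK: "K \<in> lmeasurable" using Kp by (simp add: lmeasurable_open)
  have n1: "1 \<le> real ?n" by (simp add: Suc_leI)
  have \<omega>: "0 < vol (ball (0 :: real ^ 'n) 1)" by simp
  have vK: "0 < vol K"
  proof -
    have "0 < vol (ball (0 :: real ^ 'n) \<gamma>)" using \<gamma> by simp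
    also have "\<dots> \<le> vol K" using assms(4) mK by (intro measure_mono_fmeasurable) auto
    finally show ?thesis .
  qed
  have A: "0 < ?A" using \<gamma> \<omega> by simp
  have ln_add: "ln (1 / \<delta>) + ln (x / y) = ln (x / (\<delta> * y))" if "0 < x" "0 < y" for x y
    using \<delta> that by (simp add: ln_div ln_mult)
  \<comment> \<open>In this form, distance below \<open>?R1\<close> becomes a bound on
    \<open>exp (2 * n * d)\<close>, and positivity of \<open>?R1\<close> becomes
    \<open>\<delta> * vol K < ?A\<close>.\<close>
  have R1: "2 * real ?n * ?R1 = ln (?A / (\<delta> * vol K))"
  proof -
    have "2 * real ?n * ?R1 = ln (1 / \<delta>) + ln (?A / vol K)"
      using n1 by (simp add: distrib_left)
    also have "\<dots> = ln (?A / (\<delta> * vol K))" by (rule ln_add[OF A vK])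
    finally show ?thesis .
  qed

  \<comment> \<open>Inner inclusion: points close to the origin are deep\<close>
  have "hilbert_ball K 0 ?R1 \<subseteq> depth_region K \<delta>"
  proof
    fix p assume "p \<in> hilbert_ball K 0 ?R1"
    then have p: "p \<in> K" "hilbert_dist K 0 p < ?R1"
      by (auto simp: hilbert_ball_def split: if_splits)
    show "p \<in> depth_region K \<delta>"
    proof (cases "p = 0")
      case True
      then show ?thesis using assms(8) by simp
    next
      case False
      define r where "r = \<gamma> * exp (- 2 * hilbert_dist K 0 p)"
      have "0 \<le> r" using \<gamma> by (simp add: r_def)
      have "2 * real ?n * hilbert_dist K 0 p < ln (?A / (\<delta> * vol K))"
        unfolding R1[symmetric] using p(2) n1 by (intro mult_strict_left_mono) auto
      then have "exp (2 * real ?n * hilbert_dist K 0 p) < ?A / (\<delta> * vol K)"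
        using A vK \<delta> by (metis exp_less_cancel_iff exp_ln divide_pos_pos mult_pos_pos)
      then have "\<delta> * vol K < ?A * exp (- (2 * real ?n * hilbert_dist K 0 p))"
        using \<delta> vK by (simp add: exp_minus field_simps)
      also have "exp (- (2 * real ?n * hilbert_dist K 0 p)) = exp (- 2 * hilbert_dist K 0 p) ^ ?n"
        by (simp flip: exp_of_nat_mult add: algebra_simps)
      \<comment> \<open>The exponent is not truncated because the dimension is at least 1; the
        factor 1/2 is the one for half-balls.\<close>
      also have "2 ^ (2 * ?n - 1) = (4 :: real) ^ ?n / 2"
        by (simp add: power_diff power_mult)
      \<comment> \<open>One third of the powers of \<gamma> joins the exponential to form
        \<open>r ^ n\<close>; the rest gives \<open>(4 * \<gamma>\<^sup>2) ^ n\<close>, at most 1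
        since \<open>\<gamma> \<le> 1 / 2\<close>.\<close>
      also have "4 ^ ?n / 2 * \<gamma> ^ (3 * ?n) * vol (ball (0 :: real ^ 'n) 1)
          * exp (- 2 * hilbert_dist K 0 p) ^ ?n =
          (4 * \<gamma>\<^sup>2) ^ ?n * (r ^ ?n * vol (ball (0 :: real ^ 'n) 1) / 2)"
        by (simp add: r_def power_mult_distrib power_mult eval_nat_numeral power_add)
      also have "\<dots> \<le> 1 * (r ^ ?n * vol (ball (0 :: real ^ 'n) 1) / 2)"
      proof (intro mult_right_mono power_le_one)
        show "4 * \<gamma>\<^sup>2 \<le> 1" using power_mono[of \<gamma> "1 / 2" 2] \<gamma> by (simp add: power_divide)
      qed (use \<open>0 \<le> r\<close> in auto)
      finally have low: "\<delta> * vol K < r ^ ?n * vol (ball (0 :: real ^ 'n) 1) / 2" by simp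
      have sub: "ball p r \<subseteq> K"
        unfolding r_def by (rule ball_exp_hilbert_dist_subset[OF K assms(4) \<gamma>(1) p(1) False])
      have "\<delta> \<le> vol {z \<in> K. v \<bullet> (z - p) \<ge> 0} / vol K" for v
      proof -
        have "\<delta> * vol K \<le> vol {z \<in> ball p r. v \<bullet> (z - p) \<ge> 0}"
          using low vol_half_ball_ge[OF \<open>0 \<le> r\<close>, of p v] by linarith
        also have "\<dots> \<le> vol {z \<in> K. v \<bullet> (z - p) \<ge> 0}"
          using sub halfspace_Int_lmeasurable[OF lmeasurable_ball, of p r v p]
            halfspace_Int_lmeasurable[OF mK, of v p]
          by (intro measure_mono_fmeasurable) auto
        finally show ?thesis using vK by (simp add: pos_le_divide_eq)
      qed
      then show ?thesis unfolding depth_region_def by (simp add: halfspace_depth_ge)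
    qed
  qed

  \<comment> \<open>Outer inclusion: deep points are close to the origin\<close>
  moreover have "depth_region K \<delta> \<subseteq> hilbert_ball K 0 ?R2"
  proof -
    have vK1: "vol K \<le> 1"
      by (rule vol_le_1[OF mK]) (use assms(5) in auto)
    define m where "m = \<delta> * vol K / real ?n"
    have m: "0 < m" using \<delta> vK by (simp add: m_def)
    have "\<delta> * vol K \<le> 1 / 2 * 1" using mult_mono[OF \<delta>(2) vK1] \<delta> vK by simp
    then have "m \<le> 1 / 2 * 1 / 1"
      unfolding m_def using n1 \<delta> vK by (intro frac_le) auto
    then have m2: "m \<le> 1 / 2" by simp
    have nm: "real ?n * m = \<delta> * vol K" by (simp add: m_def)
    \<comment> \<open>The factor \<open>1 / (sqrt 3 * \<gamma>)\<close> by which the stated bound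
      exceeds the cross-ratio bound \<open>X\<close> is greater than 1; this makes the distance
      estimate strict.\<close>
    have "sqrt 3 < 2" by (rule real_less_lsqrt) auto
    moreover have "sqrt 3 * \<gamma> \<le> sqrt 3 * (1 / 2)" using \<gamma> by (intro mult_left_mono) auto
    ultimately have "sqrt 3 * \<gamma> < 1" by linarith
    with \<gamma> have s: "0 < sqrt 3 * \<gamma>" "1 < 1 / (sqrt 3 * \<gamma>)" by simp_all
    have B: "0 < ?B" using \<gamma> vK n1 by (intro divide_pos_pos mult_pos_pos) auto
    have R2: "?R2 = 1 / 2 * ln ((1 / (sqrt 3 * \<gamma>)) * ((1 + 2 * \<gamma>) / (4 * \<gamma> * m)))"
    proof -
      have "?R2 = 1 / 2 * ln (1 / \<delta> * ?B)"
        using B \<delta> by (subst ln_mult) auto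
      also have "1 / \<delta> * ?B = (1 / (sqrt 3 * \<gamma>)) * ((1 + 2 * \<gamma>) / (4 * \<gamma> * m))"
        using \<gamma> \<delta> vK by (simp add: m_def field_simps power2_eq_square)
      finally show ?thesis .
    qed
    define X where "X = (1 + 2 * \<gamma>) / (4 * \<gamma> * m)"
    have "4 * \<gamma> * m \<le> 4 * \<gamma> * (1 / 2)"
      using m2 \<gamma> by (intro mult_left_mono) auto
    then have "4 * \<gamma> * m \<le> 1 + 2 * \<gamma>" using \<gamma> by linarith
    moreover have "0 < 4 * \<gamma> * m" using \<gamma> m by simp
    ultimately have X: "1 \<le> X" unfolding X_def by (subst le_divide_eq_1_pos)
    have "1 * X < (1 / (sqrt 3 * \<gamma>)) * X"
      using s X by (intro mult_strict_right_mono) auto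
    then have "ln X < ln ((1 / (sqrt 3 * \<gamma>)) * X)"
      using X by (subst ln_less_cancel_iff) linarith+
    then have big: "1 / 2 * ln X < ?R2"
      unfolding R2 X_def by linarith
    \<comment> \<open>A nonpositive radius would make the ball empty, so positivity of
      \<open>?R2\<close> is needed even for the origin itself.\<close>
    have "0 \<le> 1 / 2 * ln X" using X by simp
    then have R2pos: "0 < ?R2" using big by linarith
    show ?thesis
    proof
      fix q assume q: "q \<in> depth_region K \<delta>"
      then have qK: "q \<in> K" using depth_region_subset[OF Kp(1-3) assms(5) \<delta>(1)] by blast
      have dq: "\<delta> \<le> halfspace_depth K q" using q by (simp add: depth_region_def)
      have "hilbert_dist K 0 q < ?R2"
      proof (cases "q = 0")
        case True
        then show ?thesis using R2pos by (simp add: hilbert_dist_def)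
      next
        case False
        have "real ?n * m \<le> halfspace_depth K q * vol K" using dq vK by (simp add: nm)
        then show ?thesis
          using hilbert_dist_le_ln_depth[OF K assms(4,5) \<gamma>(1) qK False m, folded X_def] dq \<delta> big
          by linarith
      qed
      then show "q \<in> hilbert_ball K 0 ?R2" using R2pos qK by (simp add: hilbert_ball_def)
    qed
  qed

  \<comment> \<open>By the convention for nonpositive radii, a nonempty ball forces
    \<open>0 < ?R1\<close>.\<close>
  moreover have "\<delta> * vol K < ?A" if "hilbert_ball K 0 ?R1 \<noteq> {}"
  proof -
    have "0 < ?R1" using that by (auto simp: hilbert_ball_def split: if_splits)
    then have "0 < ln (?A / (\<delta> * vol K))" unfolding R1[symmetric] using n1 by simp
    then have "1 < ?A / (\<delta> * vol K)"
      using A \<delta> vK by (subst (asm) ln_gt_zero_iff) auto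
    then show ?thesis using \<delta> vK by (simp add: field_simps)
  qed
  ultimately show ?thesis by blast
qed

end
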